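(* (Banach $Q$-Contraction Principle) Let $Q$ be a family of seminorms on a separated and complete locally convex space $E$ which determines the topology of $E$, and let $T:E\to E$ be a $Q$-contraction mapping with Lipschitz constant $k\in(0,1)$, i.e. $q(Tx-Ty)\le k\,q(x-y)$ for all $x,y\in E$ and all $q\in Q$. Then: (a) There exists a unique fixed point $v\in E$ of $T$. (b) For arbitrary $x_0\in E$, the Picard iteration process defined by $x_{n+1}=T(x_n)$, $n\in\mathbb{N}_0$, converges to $v$. (c) $q(x_n-v)\le(1-k)^{-1}k^n q(x_0-x_1)$ for all $n\in\mathbb{N}_0$ and all $q\in Q$.
   Context: $\mathbb{N}_0=\mathbb{N}\cup\{0\}$. The space is separated if $\bigcap_{q\in Q}\{x\in E: q(x)=0\}=\{0\}$. *)

theory Defs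
  imports "HOL-Analysis.Analysis"
begin

class topological_real_vector = real_vector + topological_ab_group_add +
  assumes tendsto_scaleR_nhds:
    "((\<lambda>p. fst p *\<^sub>R snd p) \<longlongrightarrow> c *\<^sub>R x) (nhds c \<times>\<^sub>F nhds x)"

text \<open>
  The axiom \<open>uniformity_translation\<close> says that the uniformity is the canonical one of the
  additive topological group: its entourages are generated by the sets
  \<open>{(x, x + d) | x d. d \<in> U}\<close> with \<open>U\<close> a neighbourhood of \<open>0\<close>.  Hence \<^const>\<open>cauchy_filter\<close> and
  \<^const>\<open>complete\<close> have their usual meaning for topological vector spaces.  The axiom \<open>locally_convex\<close> spells out
  \<^const>\<open>convex\<close>, whose type class is not yet available inside a class specification.  Spaces are not
  required to be Hausdorff, and a complex space is covered by restricting its scalars to the reals.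
\<close>

class locally_convex_space = topological_real_vector + uniform_space +
  assumes uniformity_translation:
    "eventually P uniformity \<longleftrightarrow> eventually (\<lambda>d. \<forall>x. P (x, x + d)) (nhds 0)"
  and locally_convex:
    "open U \<Longrightarrow> 0 \<in> U \<Longrightarrow>
      \<exists>C. open C \<and> 0 \<in> C \<and> C \<subseteq> U \<and>
        (\<forall>x\<in>C. \<forall>y\<in>C. \<forall>u\<ge>0. \<forall>v\<ge>0. u + v = 1 \<longrightarrow> u *\<^sub>R x + v *\<^sub>R y \<in> C)"

instance real_normed_vector \<subseteq> topological_real_vector
proof
  fix c :: real and x :: 'a
  show "((\<lambda>p. fst p *\<^sub>R snd p) \<longlongrightarrow> c *\<^sub>R x) (nhds c \<times>\<^sub>F nhds x)"
    by (intro tendsto_scaleR filterlim_fst filterlim_snd)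
qed

instance real_normed_vector \<subseteq> locally_convex_space
proof
  fix P :: "'a \<times> 'a \<Rightarrow> bool"
  show "eventually P uniformity \<longleftrightarrow> eventually (\<lambda>d. \<forall>x. P (x, x + d)) (nhds 0)"
  proof
    assume "eventually P uniformity"
    then obtain e where e: "e > 0" "\<And>x y. dist x y < e \<Longrightarrow> P (x, y)"
      unfolding eventually_uniformity_metric by blast
    have "P (x, x + d)" if "dist d 0 < e" for x d
      using that by (intro e) (simp add: dist_norm)
    then show "eventually (\<lambda>d. \<forall>x. P (x, x + d)) (nhds 0)"
      unfolding eventually_nhds_metric using e(1) by blast
  next
    assume "eventually (\<lambda>d. \<forall>x. P (x, x + d)) (nhds 0)"
    then obtain e where e: "e > 0" "\<And>x d. dist d 0 < e \<Longrightarrow> P (x, x + d)"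
      unfolding eventually_nhds_metric by blast
    have "P (x, y)" if "dist x y < e" for x y
      using e(2)[of "y - x" x] that by (simp add: dist_norm norm_minus_commute)
    then show "eventually P uniformity"
      unfolding eventually_uniformity_metric using e(1) by blast
  qed
next
  fix U :: "'a set"
  assume "open U" "0 \<in> U"
  then obtain e where "e > 0" "ball 0 e \<subseteq> U"
    unfolding open_contains_ball by blast
  moreover have "convex (ball (0::'a) e)"
    by (rule convex_ball)
  ultimately show "\<exists>C. open C \<and> 0 \<in> C \<and> C \<subseteq> U \<and>
      (\<forall>x\<in>C. \<forall>y\<in>C. \<forall>u\<ge>0. \<forall>v\<ge>0. u + v = 1 \<longrightarrow> u *\<^sub>R x + v *\<^sub>R y \<in> C)"
    unfolding convex_def by (intro exI[of _ "ball 0 e"]) auto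
qed

definition seminorm :: "('a::real_vector \<Rightarrow> real) \<Rightarrow> bool" where
  "seminorm q \<longleftrightarrow>
     (\<forall>x. 0 \<le> q x) \<and> (\<forall>c x. q (c *\<^sub>R x) = \<bar>c\<bar> * q x) \<and> (\<forall>x y. q (x + y) \<le> q x + q y)"

definition determines_topology :: "('a::{real_vector,topological_space} \<Rightarrow> real) set \<Rightarrow> bool" where
  "determines_topology Q \<longleftrightarrow>
     (\<forall>U::'a set. open U \<longleftrightarrow>
        generate_topology {{y. q (y - x) < e} | q x e. q \<in> Q \<and> 0 < e} U)"

definition separated :: "('a::real_vector \<Rightarrow> real) set \<Rightarrow> bool" where
  "separated Q \<longleftrightarrow> (\<Inter>q\<in>Q. {x. q x = 0}) = {0}"

definition Q_contraction ::
    "('a::real_vector \<Rightarrow> real) set \<Rightarrow> real \<Rightarrow> ('a \<Rightarrow> 'a) \<Rightarrow> bool" where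
  "Q_contraction Q k T \<longleftrightarrow>
     0 < k \<and> k < 1 \<and> (\<forall>x y. \<forall>q\<in>Q. q (T x - T y) \<le> k * q (x - y))"

primrec picard :: "('a \<Rightarrow> 'a) \<Rightarrow> 'a \<Rightarrow> nat \<Rightarrow> 'a" where
  "picard T x0 0 = x0"
| "picard T x0 (Suc n) = T (picard T x0 n)"

end

theory Submission
  imports Defs
begin

text \<open>
  The proof follows Palais. For a seminorm \<open>q\<close> contracted by \<open>T\<close>, the triangle inequality along
  \<open>x, T x, T y, y\<close> gives
  \<open>q (x - y) \<le> (q (x - T x) + q (y - T y)) / (1 - k)\<close>:
  the distance of two points is controlled by how far each is from being fixed. Since
  \<open>q (x\<^sub>n - T x\<^sub>n) \<le> k\<^sup>n q (x\<^sub>0 - x\<^sub>1)\<close> along a Picard sequence, this single inequality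
  (\<open>seminorm_contraction_fundamental\<close>) yields everything quantitative. For two iterates it shows
  that the sequence is Cauchy with respect to each \<open>q\<close>, for an iterate and a fixed point it is
  the a priori error estimate, and for two fixed points it gives \<open>q (v - w) = 0\<close>, hence uniqueness by
  separation.

  The passage between the seminorms and the topology is \<open>tendsto_iff_seminorms\<close>: convergence is
  convergence of every \<open>q (f x - l)\<close> to \<open>0\<close>. As the uniformity is translation invariant, the same
  lemma, applied to the differences of two iterates, also produces Cauchy filters
  (\<open>cauchy_filter_if_seminorms\<close>), and completeness provides the limit, which is fixed by \<open>T\<close>
  because each \<open>q\<close> vanishes on \<open>v - T v\<close>.
\<close>

section \<open>Seminorms\<close>

lemma seminorm_nonneg: "seminorm q \<Longrightarrow> 0 \<le> q x"
  by (simp add: seminorm_def)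

lemma seminorm_zero:
  assumes "seminorm q" shows "q 0 = 0"
proof -
  have "q (0 *\<^sub>R 0) = \<bar>0\<bar> * q 0"
    using assms unfolding seminorm_def by blast
  then show ?thesis by simp
qed

lemma seminorm_minus_commute:
  assumes "seminorm q" shows "q (x - y) = q (y - x)"
proof -
  have "q ((-1) *\<^sub>R (y - x)) = \<bar>-1\<bar> * q (y - x)"
    using assms unfolding seminorm_def by blast
  then show ?thesis by simp
qed

lemma seminorm_triangle:
  assumes "seminorm q" shows "q (x - z) \<le> q (x - y) + q (y - z)"
proof -
  have "q ((x - y) + (y - z)) \<le> q (x - y) + q (y - z)"
    using assms unfolding seminorm_def by blast
  then show ?thesis by simp
qed

lemma separated_eq:
  assumes "separated Q" and "\<And>q. q \<in> Q \<Longrightarrow> q (x - y) = 0"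
  shows "x = y"
proof -
  have "x - y \<in> (\<Inter>q\<in>Q. {x. q x = 0})"
    using assms(2) by blast
  then show ?thesis
    using assms(1) by (simp only: separated_def) simp
qed

section \<open>Convergence and Cauchy filters in terms of seminorms\<close>

text \<open>
  The generating sets of the topology are balls with arbitrary centres \<open>x\<close>; such a ball
  around a point \<open>l\<close> contains a ball centred at \<open>l\<close>, by the triangle inequality. Finite
  intersections and unions are then handled by the induction on generated open sets, so that
  no explicit neighbourhood base is needed.
\<close>

lemma tendsto_iff_seminorms:
  fixes f :: "'b \<Rightarrow> 'a::{real_vector,topological_space}"
  assumes Q: "\<forall>q\<in>Q. seminorm q" and top: "determines_topology Q"
  shows "(f \<longlongrightarrow> l) F \<longleftrightarrow> (\<forall>q\<in>Q. ((\<lambda>x. q (f x - l)) \<longlongrightarrow> 0) F)"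
proof
  assume lim: "(f \<longlongrightarrow> l) F"
  show "\<forall>q\<in>Q. ((\<lambda>x. q (f x - l)) \<longlongrightarrow> 0) F"
  proof
    fix q assume q: "q \<in> Q"
    then have sq: "seminorm q" using Q by blast
    show "((\<lambda>x. q (f x - l)) \<longlongrightarrow> 0) F"
    proof (rule tendstoI)
      fix e :: real assume "0 < e"
      then have "generate_topology {{y. q (y - x) < e} | q x e. q \<in> Q \<and> 0 < e} {y. q (y - l) < e}"
        using q by (intro generate_topology.Basis) blast
      then have "open {y. q (y - l) < e}"
        using top by (simp add: determines_topology_def)
      moreover have "l \<in> {y. q (y - l) < e}"
        using \<open>0 < e\<close> seminorm_zero[OF sq] by simp
      ultimately have "eventually (\<lambda>x. f x \<in> {y. q (y - l) < e}) F"
        using lim by (rule topological_tendstoD[rotated])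
      then show "eventually (\<lambda>x. dist (q (f x - l)) 0 < e) F"
        using seminorm_nonneg[OF sq] by (simp add: dist_real_def)
    qed
  qed
next
  assume lim: "\<forall>q\<in>Q. ((\<lambda>x. q (f x - l)) \<longlongrightarrow> 0) F"
  show "(f \<longlongrightarrow> l) F"
  proof (rule topological_tendstoI)
    fix U :: "'a set" assume "open U" and "l \<in> U"
    then have "generate_topology {{y. q (y - x) < e} | q x e. q \<in> Q \<and> 0 < e} U"
      using top by (simp add: determines_topology_def)
    then show "eventually (\<lambda>x. f x \<in> U) F"
      using \<open>l \<in> U\<close>
    proof (induction rule: generate_topology.induct)
      case UNIV
      then show ?case by simp
    next
      case (Int A B)
      then show ?case by (auto intro: eventually_conj)
    next
      case (UN K)
      then obtain A where A: "A \<in> K" "l \<in> A" by blast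
      then have "eventually (\<lambda>x. f x \<in> A) F" using UN.IH by blast
      then show ?case using A(1) by (auto elim: eventually_mono)
    next
      case (Basis S)
      then obtain q c e where q: "q \<in> Q" and S: "S = {y. q (y - c) < e}" by blast
      have "0 < e - q (l - c)" using Basis.prems S by simp
      with lim q have "eventually (\<lambda>x. q (f x - l) < e - q (l - c)) F"
        by (intro order_tendstoD(2)) auto
      then show ?case
      proof (rule eventually_mono)
        fix x assume "q (f x - l) < e - q (l - c)"
        then show "f x \<in> S"
          using seminorm_triangle[OF bspec[OF Q q], of "f x" c l] by (simp add: S)
      qed
    qed
  qed
qed

text \<open>
  An entourage is a condition on the difference of its two coordinates, so the Cauchy property
  says that \<open>f y - f x\<close> tends to \<open>0\<close> along the product filter.
\<close>

lemma cauchy_filter_if_seminorms: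
  fixes f :: "'b \<Rightarrow> 'a::locally_convex_space"
  assumes Q: "\<forall>q\<in>Q. seminorm q" and top: "determines_topology Q"
    and lim: "\<And>q. q \<in> Q \<Longrightarrow> ((\<lambda>p. q (f (snd p) - f (fst p))) \<longlongrightarrow> 0) (F \<times>\<^sub>F F)"
  shows "cauchy_filter (filtermap f F)"
proof -
  have diff: "((\<lambda>p. f (snd p) - f (fst p)) \<longlongrightarrow> 0) (F \<times>\<^sub>F F)"
    unfolding tendsto_iff_seminorms[OF Q top] using lim by simp
  have "eventually P (filtermap f F \<times>\<^sub>F filtermap f F)"
    if "eventually P uniformity" for P :: "'a \<times> 'a \<Rightarrow> bool"
  proof -
    have "eventually (\<lambda>d. \<forall>x. P (x, x + d)) (nhds 0)"
      using that by (simp add: uniformity_translation)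
    then have "eventually (\<lambda>p. \<forall>x. P (x, x + (f (snd p) - f (fst p)))) (F \<times>\<^sub>F F)"
      using diff by (rule eventually_compose_filterlim)
    then have "eventually (\<lambda>p. P (f (fst p), f (snd p))) (F \<times>\<^sub>F F)"
    proof (rule eventually_mono)
      fix p assume "\<forall>x. P (x, x + (f (snd p) - f (fst p)))"
      then have "P (f (fst p), f (fst p) + (f (snd p) - f (fst p)))" by blast
      then show "P (f (fst p), f (snd p))" by simp
    qed
    then show ?thesis
      by (simp add: prod_filtermap1 prod_filtermap2 eventually_filtermap case_prod_beta)
  qed
  then show ?thesis
    unfolding cauchy_filter_def by (intro filter_leI)
qed

section \<open>Contractions with respect to one seminorm\<close>

text \<open>
  In \<open>q (x - y) \<le> q (x - T x) + q (T x - T y) + q (T y - y)\<close> the middle term is at most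
  \<open>k q (x - y)\<close>, which is absorbed on the left because \<open>k < 1\<close>.
\<close>

lemma seminorm_contraction_fundamental:
  assumes q: "seminorm q" and "k < 1" and contr: "q (T x - T y) \<le> k * q (x - y)"
  shows "q (x - y) \<le> inverse (1 - k) * (q (x - T x) + q (y - T y))"
proof -
  have "q (x - y) \<le> q (x - T x) + q (T x - y)"
    by (rule seminorm_triangle[OF q])
  also have "q (T x - y) \<le> q (T x - T y) + q (T y - y)"
    by (rule seminorm_triangle[OF q])
  also have "q (T y - y) = q (y - T y)"
    by (rule seminorm_minus_commute[OF q])
  finally have "(1 - k) * q (x - y) \<le> q (x - T x) + q (y - T y)"
    using contr by (simp add: algebra_simps)
  then show ?thesis
    using \<open>k < 1\<close> by (simp add: field_simps)
qed

lemma picard_step_bound: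
  fixes q :: "'a::real_vector \<Rightarrow> real"
  assumes contr: "\<And>x y. q (T x - T y) \<le> k * q (x - y)" and "0 \<le> k"
  shows "q (picard T x0 n - T (picard T x0 n)) \<le> k ^ n * q (x0 - T x0)"
proof (induction n)
  case 0
  then show ?case by simp
next
  case (Suc n)
  have "q (picard T x0 (Suc n) - T (picard T x0 (Suc n)))
      \<le> k * q (picard T x0 n - T (picard T x0 n))"
    using contr by simp
  also have "\<dots> \<le> k * (k ^ n * q (x0 - T x0))"
    using Suc.IH \<open>0 \<le> k\<close> by (rule mult_left_mono)
  finally show ?case by (simp add: mult.assoc)
qed

lemma picard_seminorm_Cauchy:
  assumes q: "seminorm q" and contr: "\<And>x y. q (T x - T y) \<le> k * q (x - y)"
    and k: "0 \<le> k" "k < 1"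
  shows "((\<lambda>p. q (picard T x0 (snd p) - picard T x0 (fst p))) \<longlongrightarrow> 0)
           (sequentially \<times>\<^sub>F sequentially)"
proof (rule tendsto_sandwich[OF _ _ tendsto_const])
  define B where "B = (\<lambda>p :: nat \<times> nat.
    inverse (1 - k) * (k ^ snd p * q (x0 - T x0) + k ^ fst p * q (x0 - T x0)))"
  have "q (picard T x0 (snd p) - picard T x0 (fst p)) \<le> B p" for p :: "nat \<times> nat"
  proof -
    have "q (picard T x0 (snd p) - picard T x0 (fst p)) \<le> inverse (1 - k) *
        (q (picard T x0 (snd p) - T (picard T x0 (snd p))) +
         q (picard T x0 (fst p) - T (picard T x0 (fst p))))"
      by (rule seminorm_contraction_fundamental[of q, OF q k(2) contr])
    also have "\<dots> \<le> B p"
      unfolding B_def using k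
      by (intro mult_left_mono add_mono picard_step_bound[of q, OF contr]) auto
    finally show ?thesis .
  qed
  then show "eventually (\<lambda>p. q (picard T x0 (snd p) - picard T x0 (fst p)) \<le> B p)
      (sequentially \<times>\<^sub>F sequentially)"
    by simp
  have pow: "(\<lambda>n. k ^ n) \<longlonglongrightarrow> 0"
    using k by (intro LIMSEQ_realpow_zero)
  have "(B \<longlongrightarrow> inverse (1 - k) * (0 * q (x0 - T x0) + 0 * q (x0 - T x0)))
      (sequentially \<times>\<^sub>F sequentially)"
    unfolding B_def
    by (intro tendsto_intros filterlim_compose[OF pow filterlim_fst]
        filterlim_compose[OF pow filterlim_snd])
  then show "(B \<longlongrightarrow> 0) (sequentially \<times>\<^sub>F sequentially)"
    by simp
qed (simp add: seminorm_nonneg[OF q])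

text \<open>
  With respect to \<open>q\<close>, the shifted sequence \<open>x\<^sub>n\<^sub>+\<^sub>1 = T x\<^sub>n\<close> tends to \<open>v\<close>, and also to
  \<open>T v\<close> because \<open>T\<close> is \<open>q\<close>-Lipschitz.
\<close>

lemma picard_limit_seminorm_fixed:
  assumes q: "seminorm q" and contr: "\<And>x y. q (T x - T y) \<le> k * q (x - y)"
    and lim: "(\<lambda>n. q (picard T x0 n - v)) \<longlonglongrightarrow> 0"
  shows "q (v - T v) = 0"
proof -
  have "q (v - T v) \<le> q (picard T x0 (Suc n) - v) + k * q (picard T x0 n - v)" for n
    using seminorm_triangle[OF q, of v "T v" "picard T x0 (Suc n)"]
      seminorm_minus_commute[OF q, of v "picard T x0 (Suc n)"]
      contr[of "picard T x0 n" v] by simp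
  moreover have "(\<lambda>n. q (picard T x0 (Suc n) - v) + k * q (picard T x0 n - v)) \<longlonglongrightarrow> 0 + k * 0"
    by (intro tendsto_intros lim LIMSEQ_Suc[OF lim])
  ultimately have "q (v - T v) \<le> 0 + k * 0"
    by (intro LIMSEQ_le_const) auto
  then show ?thesis
    using seminorm_nonneg[OF q, of "v - T v"] by simp
qed

section \<open>The contraction principle\<close>

theorem theorem3p2:
  fixes Q :: "('a::locally_convex_space \<Rightarrow> real) set"
    and T :: "'a \<Rightarrow> 'a"
    and k :: real
  assumes "\<forall>q\<in>Q. seminorm q"
    and "determines_topology Q"
    and "separated Q"
    and "complete (UNIV :: 'a set)"
    and "Q_contraction Q k T"
  shows "\<exists>v. (T v = v \<and> (\<forall>w. T w = w \<longrightarrow> w = v)) \<and>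
             (\<forall>x0. picard T x0 \<longlonglongrightarrow> v) \<and>
             (\<forall>x0 n. \<forall>q\<in>Q. q (picard T x0 n - v)
                \<le> inverse (1 - k) * k ^ n * q (picard T x0 0 - picard T x0 1))"
proof -
  note Q = bspec[OF assms(1)]
  have k: "0 < k" "k < 1"
    using assms(5) by (auto simp: Q_contraction_def)
  have contr: "q (T x - T y) \<le> k * q (x - y)" if "q \<in> Q" for q x y
    using assms(5) that unfolding Q_contraction_def by blast
  note lim_iff = tendsto_iff_seminorms[OF assms(1,2)]

  have "cauchy_filter (filtermap (picard T 0) sequentially)"
  proof (rule cauchy_filter_if_seminorms[OF assms(1,2)])
    fix q assume q: "q \<in> Q"
    show "((\<lambda>p. q (picard T 0 (snd p) - picard T 0 (fst p))) \<longlongrightarrow> 0)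
        (sequentially \<times>\<^sub>F sequentially)"
      using k by (intro picard_seminorm_Cauchy[of q, OF Q[OF q] contr[OF q]]) auto
  qed
  moreover have "filtermap (picard T 0) sequentially \<noteq> bot"
    by (simp add: filtermap_bot_iff)
  ultimately obtain v where v: "filtermap (picard T 0) sequentially \<le> nhds v"
    using assms(4) unfolding complete_uniform by (metis principal_UNIV top_greatest)
  then have "picard T 0 \<longlonglongrightarrow> v"
    by (simp add: filterlim_def)
  then have lim: "\<forall>q\<in>Q. (\<lambda>n. q (picard T 0 n - v)) \<longlonglongrightarrow> 0"
    unfolding lim_iff .
  have "q (v - T v) = 0" if q: "q \<in> Q" for q
    by (rule picard_limit_seminorm_fixed[of q, OF Q[OF q] contr[OF q] bspec[OF lim q]])
  then have fixed: "T v = v"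
    using separated_eq[OF assms(3), of v "T v"] by simp

  have unique: "w = v" if "T w = w" for w
  proof (rule separated_eq[OF assms(3)])
    fix q assume q: "q \<in> Q"
    have "q (w - v) \<le> inverse (1 - k) * (q (w - T w) + q (v - T v))"
      by (rule seminorm_contraction_fundamental[of q, OF Q[OF q] k(2) contr[OF q]])
    then show "q (w - v) = 0"
      using seminorm_nonneg[OF Q[OF q], of "w - v"]
      by (simp add: that fixed seminorm_zero[OF Q[OF q]])
  qed

  have estimate: "q (picard T x0 n - v) \<le> inverse (1 - k) * k ^ n * q (picard T x0 0 - picard T x0 1)"
    if q: "q \<in> Q" for q x0 n
  proof -
    have "q (picard T x0 n - v) \<le>
        inverse (1 - k) * (q (picard T x0 n - T (picard T x0 n)) + q (v - T v))"
      by (rule seminorm_contraction_fundamental[of q, OF Q[OF q] k(2) contr[OF q]])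
    also have "\<dots> = inverse (1 - k) * q (picard T x0 n - T (picard T x0 n))"
      by (simp add: fixed seminorm_zero[OF Q[OF q]])
    also have "\<dots> \<le> inverse (1 - k) * (k ^ n * q (x0 - T x0))"
      using k by (intro mult_left_mono picard_step_bound[of q, OF contr[OF q]]) auto
    finally show ?thesis
      by (simp add: mult.assoc)
  qed

  have convergence: "picard T x0 \<longlonglongrightarrow> v" for x0
    unfolding lim_iff
  proof
    fix q assume q: "q \<in> Q"
    show "(\<lambda>n. q (picard T x0 n - v)) \<longlonglongrightarrow> 0"
    proof (rule tendsto_sandwich[OF _ _ tendsto_const])
      show "eventually (\<lambda>n. 0 \<le> q (picard T x0 n - v)) sequentially"
        by (simp add: seminorm_nonneg[OF Q[OF q]])
      show "eventually (\<lambda>n. q (picard T x0 n - v) \<le>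
          inverse (1 - k) * k ^ n * q (picard T x0 0 - picard T x0 1)) sequentially"
        by (intro always_eventually allI estimate q)
      have "(\<lambda>n. k ^ n) \<longlonglongrightarrow> 0"
        using k by (intro LIMSEQ_realpow_zero) auto
      from tendsto_mult_left_zero[OF tendsto_mult_right_zero[OF this]]
      show "(\<lambda>n. inverse (1 - k) * k ^ n * q (picard T x0 0 - picard T x0 1)) \<longlonglongrightarrow> 0" .
    qed
  qed
  show ?thesis
    by (intro exI[of _ v] conjI allI impI ballI fixed convergence) (fact unique estimate)+
qed

end
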